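(* If $G$ is a graph with $n = |V(G)|$, then $$\chi_D(G) + \chi_D(\overline{G}) \le n + D(G).$$
   Context: Graphs are finite and simple; $\overline{G}$ denotes the complement of $G$. A labeling (coloring) $h: V(G)\to\{1,\dots,r\}$ is distinguishing if the only automorphism of $G$ that preserves all vertex labels is the identity. The distinguishing number $D(G)$ is the minimum $r$ such that $G$ has a distinguishing labeling with labels in $\{1,\dots,r\}$. The distinguishing chromatic number $\chi_D(G)$ is the minimum $r$ such that $G$ has a labeling with labels in $\{1,\dots,r\}$ that is both a proper coloring and distinguishing. *)

theory Defs
  imports "Graph_Theory.Pair_Digraph" "HOL-Combinatorics.Permutations"
begin

(* A finite simple graph is a digraph satisfying the locale predicate pair_graph: an undirected
   edge uv is the pair of arcs (u,v) and (v,u). The graph without vertices is included. *)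

definition complement :: "'a pair_pre_digraph \<Rightarrow> 'a pair_pre_digraph" where
  "complement G = \<lparr> pverts = pverts G,
     parcs = {(u, v). u \<in> pverts G \<and> v \<in> pverts G \<and> u \<noteq> v \<and> (u, v) \<notin> parcs G} \<rparr>"

(* An automorphism is extended by the identity outside the vertex set (permutes), so that the
   identity automorphism is exactly id. *)
definition automorphism :: "'a pair_pre_digraph \<Rightarrow> ('a \<Rightarrow> 'a) \<Rightarrow> bool" where
  "automorphism G f \<longleftrightarrow> f permutes pverts G \<and>
     (\<forall>u \<in> pverts G. \<forall>v \<in> pverts G. (f u, f v) \<in> parcs G \<longleftrightarrow> (u, v) \<in> parcs G)"

definition labeling :: "'a pair_pre_digraph \<Rightarrow> nat \<Rightarrow> ('a \<Rightarrow> nat) \<Rightarrow> bool" where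
  "labeling G r h \<longleftrightarrow> h \<in> pverts G \<rightarrow> {1..r}"

definition distinguishing :: "'a pair_pre_digraph \<Rightarrow> ('a \<Rightarrow> nat) \<Rightarrow> bool" where
  "distinguishing G h \<longleftrightarrow>
     (\<forall>f. automorphism G f \<and> (\<forall>v \<in> pverts G. h (f v) = h v) \<longrightarrow> f = id)"

definition proper_coloring :: "'a pair_pre_digraph \<Rightarrow> ('a \<Rightarrow> nat) \<Rightarrow> bool" where
  "proper_coloring G h \<longleftrightarrow> (\<forall>(u, v) \<in> parcs G. h u \<noteq> h v)"

definition distinguishing_number :: "'a pair_pre_digraph \<Rightarrow> nat" where
  "distinguishing_number G = (LEAST r. \<exists>h. labeling G r h \<and> distinguishing G h)"

definition distinguishing_chromatic_number :: "'a pair_pre_digraph \<Rightarrow> nat" where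
  "distinguishing_chromatic_number G =
     (LEAST r. \<exists>h. labeling G r h \<and> proper_coloring G h \<and> distinguishing G h)"

lemma pair_graph_complement:
  assumes "pair_graph G"
  shows "pair_graph (complement G)"
proof -
  interpret pair_graph G by fact
  have "parcs (complement G) \<subseteq> pverts G \<times> pverts G"
    by (auto simp: complement_def)
  then have "finite (parcs (complement G))"
    using finite_subset pair_finite_verts by blast
  moreover have "sym (parcs G)"
    using pair_sym_arcs by (simp add: symmetric_def)
  ultimately show ?thesis
    using pair_finite_verts
    by unfold_locales (auto simp: complement_def symmetric_def sym_def)
qed

(* The minima defining the two numbers range over nonempty sets, so LEAST is meaningful. *)
lemma ex_proper_distinguishing:
  assumes "pair_graph G"
  shows "\<exists>h. labeling G (card (pverts G)) h \<and> proper_coloring G h \<and> distinguishing G h"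
proof -
  interpret pair_graph G by fact
  obtain h where h: "bij_betw h (pverts G) {1..card (pverts G)}"
    using ex_bij_betw_finite_nat[OF pair_finite_verts]
      bij_betw_iff_card[OF pair_finite_verts, of "{1..card (pverts G)}"] by auto
  then have inj: "inj_on h (pverts G)" by (rule bij_betw_imp_inj_on)
  have "labeling G (card (pverts G)) h"
    using h by (auto simp: labeling_def bij_betw_def)
  moreover have "proper_coloring G h"
    using inj pair_no_loops wellformed'
    by (fastforce simp: proper_coloring_def dest: inj_onD)
  moreover have "distinguishing G h"
    unfolding distinguishing_def automorphism_def
  proof (intro allI impI ext, elim conjE)
    fix f x
    assume f: "f permutes pverts G" and "\<forall>v\<in>pverts G. h (f v) = h v"
    then show "f x = id x"
      by (cases "x \<in> pverts G")
        (auto simp: permutes_in_image permutes_not_in dest!: inj_onD[OF inj])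
  qed
  ultimately show ?thesis by blast
qed

end

theory Submission
  imports Defs
begin

text \<open>
  Fix a distinguishing labeling of \<open>G\<close> with \<open>D = D(G)\<close> labels and let \<open>V\<^sub>1, \<dots>, V\<^sub>D\<close> be its label
  classes. Color every \<open>V\<^sub>i\<close> properly, using disjoint palettes for different classes. The result is
  a proper coloring of \<open>G\<close> that refines the labeling, so every automorphism preserving it preserves
  the labeling and is the identity (\<open>distinguishing_chromatic_number_le_sum\<close>). The same works
  for the complement with the same labeling, because a graph and its complement have the same
  automorphisms. Hence \<open>\<chi>\<^sub>D(G) + \<chi>\<^sub>D(complement G)\<close> is at most the sum over \<open>i\<close> of
  \<open>\<chi>(G[V\<^sub>i]) + \<chi>(complement G[V\<^sub>i])\<close>. By the classical inequality of Nordhaus and Gaddum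
  (\<open>nordhaus_gaddum\<close>) the \<open>i\<close>-th summand is at most \<open>|V\<^sub>i| + 1\<close>, and these bounds add up to \<open>n + D\<close>.
\<close>

text \<open>
  Stated for a relation and a vertex set rather than for a graph, so that induced subgraphs and
  their complements need no construction of their own.
\<close>
definition colors_on :: "('a \<times> 'a) set \<Rightarrow> 'a set \<Rightarrow> nat \<Rightarrow> ('a \<Rightarrow> nat) \<Rightarrow> bool" where
  "colors_on R S k f \<longleftrightarrow> f \<in> S \<rightarrow> {..<k} \<and> (\<forall>u\<in>S. \<forall>v\<in>S. (u, v) \<in> R \<longrightarrow> f u \<noteq> f v)"

lemma colors_on_insert_new_color:
  assumes "colors_on R S k f" "v \<notin> S" "(v, v) \<notin> R"
  shows "colors_on R (insert v S) (Suc k) (f(v := k))"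
  using assms by (fastforce simp: colors_on_def Pi_iff)

text \<open>The greedy step: fewer than \<open>k\<close> neighbours leave one of the \<open>k\<close> colors free.\<close>
lemma colors_on_insert_free_color:
  assumes f: "colors_on R S k f" and v: "v \<notin> S" "(v, v) \<notin> R"
    and "sym R" "finite S" and few: "card {u \<in> S. (u, v) \<in> R} < k"
  shows "\<exists>f'. colors_on R (insert v S) k f'"
proof -
  let ?N = "{u \<in> S. (u, v) \<in> R}"
  have "card (f ` ?N) < card {..<k}"
    using card_image_le[of ?N f] few \<open>finite S\<close> by simp
  then have "\<not> {..<k} \<subseteq> f ` ?N"
    using card_mono[of "f ` ?N" "{..<k}"] \<open>finite S\<close> by auto
  then obtain c where "c < k" "c \<notin> f ` ?N" by blast
  then have "colors_on R (insert v S) k (f(v := c))"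
    using f v symD[OF \<open>sym R\<close>] by (fastforce simp: colors_on_def Pi_iff)
  then show ?thesis by blast
qed

text \<open>
  The inequality of Nordhaus and Gaddum, by adding one vertex \<open>v\<close> to \<open>S\<close>. If one of the two
  colorings extends to \<open>v\<close> without a new color, then one new color for the other suffices. Otherwise
  \<open>v\<close> has at least \<open>a\<close> neighbours and at least \<open>b\<close> non-neighbours in \<open>S\<close>, so \<open>a + b \<le> |S|\<close>, and
  there is room for a new color in both.
\<close>
lemma nordhaus_gaddum:
  assumes "finite S" "sym R" "irrefl R"
  shows "\<exists>a b f g. a + b \<le> card S + 1 \<and> colors_on R S a f \<and> colors_on (- (R \<union> Id)) S b g"
  using \<open>finite S\<close>
proof (induction S rule: finite_induct)
  case empty
  have "colors_on T {} 0 f" for T :: "('a \<times> 'a) set" and f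
    by (simp add: colors_on_def)
  then have "0 + 0 \<le> card ({} :: 'a set) + 1 \<and> colors_on R {} 0 (\<lambda>_. 0) \<and>
      colors_on (- (R \<union> Id)) {} 0 (\<lambda>_. 0)" by simp
  then show ?case by blast
next
  case (insert v S)
  let ?R' = "- (R \<union> Id)"
  from insert.IH obtain a b f g where ab: "a + b \<le> card S + 1"
    and f: "colors_on R S a f" and g: "colors_on ?R' S b g" by blast
  have vR: "(v, v) \<notin> R" "(v, v) \<notin> ?R'"
    using \<open>irrefl R\<close> by (auto simp: irrefl_def)
  have symR': "sym ?R'"
    using \<open>sym R\<close> by (auto simp: sym_def)
  note f_new = colors_on_insert_new_color[OF f \<open>v \<notin> S\<close> vR(1)]
  note g_new = colors_on_insert_new_color[OF g \<open>v \<notin> S\<close> vR(2)]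
  let ?N = "{u \<in> S. (u, v) \<in> R}" and ?N' = "{u \<in> S. (u, v) \<in> ?R'}"
  consider "card ?N < a" | "card ?N' < b" | "a \<le> card ?N" "b \<le> card ?N'" by linarith
  then show ?case
  proof cases
    case 1
    then obtain f' where "colors_on R (insert v S) a f'"
      using colors_on_insert_free_color[OF f \<open>v \<notin> S\<close> vR(1) \<open>sym R\<close> \<open>finite S\<close>] by blast
    moreover have "a + Suc b \<le> card (insert v S) + 1"
      using ab insert.hyps by simp
    ultimately show ?thesis using g_new by blast
  next
    case 2
    then obtain g' where "colors_on ?R' (insert v S) b g'"
      using colors_on_insert_free_color[OF g \<open>v \<notin> S\<close> vR(2) symR' \<open>finite S\<close>] by blast
    moreover have "Suc a + b \<le> card (insert v S) + 1"
      using ab insert.hyps by simp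
    ultimately show ?thesis using f_new by blast
  next
    case 3
    have "card ?N + card ?N' = card (?N \<union> ?N')"
      using \<open>finite S\<close> by (subst card_Un_disjoint) auto
    also have "\<dots> \<le> card S"
      using \<open>finite S\<close> by (intro card_mono) auto
    finally have "Suc a + Suc b \<le> card (insert v S) + 1"
      using 3 insert.hyps by simp
    then show ?thesis using f_new g_new by blast
  qed
qed

text \<open>Colors of any type may be renamed injectively to \<open>1, \<dots>, |C|\<close>.\<close>
lemma distinguishing_chromatic_number_le_card:
  assumes "finite C" "c \<in> pverts G \<rightarrow> C"
    and proper: "\<And>u v. (u, v) \<in> parcs G \<Longrightarrow> c u \<noteq> c v"
    and dist: "\<And>f. automorphism G f \<Longrightarrow> (\<And>v. v \<in> pverts G \<Longrightarrow> c (f v) = c v) \<Longrightarrow> f = id"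
    and wf: "parcs G \<subseteq> pverts G \<times> pverts G"
  shows "distinguishing_chromatic_number G \<le> card C"
proof -
  obtain e where e: "bij_betw e C {1..card C}"
    using bij_betw_iff_card[OF \<open>finite C\<close>, of "{1..card C}"] by auto
  have e_eq: "e (c u) = e (c v) \<longleftrightarrow> c u = c v" if "u \<in> pverts G" "v \<in> pverts G" for u v
    using bij_betw_imp_inj_on[OF e] that \<open>c \<in> pverts G \<rightarrow> C\<close> by (auto simp: inj_on_def)
  have "labeling G (card C) (e \<circ> c)"
    using bij_betwE[OF e] \<open>c \<in> pverts G \<rightarrow> C\<close> by (auto simp: labeling_def)
  moreover have "proper_coloring G (e \<circ> c)"
    using proper wf e_eq by (fastforce simp: proper_coloring_def)
  moreover have "distinguishing G (e \<circ> c)"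
    unfolding distinguishing_def
  proof (intro allI impI, elim conjE)
    fix f assume f: "automorphism G f" and pres: "\<forall>v\<in>pverts G. (e \<circ> c) (f v) = (e \<circ> c) v"
    have "f v \<in> pverts G" if "v \<in> pverts G" for v
      using f that by (simp add: automorphism_def permutes_in_image)
    then show "f = id"
      using dist[OF f] pres e_eq by simp
  qed
  ultimately show ?thesis
    unfolding distinguishing_chromatic_number_def by (intro Least_le) blast
qed

text \<open>
  Pairing the label of a vertex with its color inside its label class gives the disjoint palettes:
  vertices of different classes differ in the first component, adjacent vertices of one class in
  the second, and the first component alone is already distinguishing.
\<close>
lemma distinguishing_chromatic_number_le_sum:
  assumes "labeling G r h" "distinguishing G h"
    and wf: "parcs G \<subseteq> pverts G \<times> pverts G"
    and col: "\<And>i. colors_on (parcs G) {v \<in> pverts G. h v = i} (k i) (f i)"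
  shows "distinguishing_chromatic_number G \<le> (\<Sum>i=1..r. k i)"
proof -
  let ?c = "\<lambda>v. (h v, f (h v) v)"
  have "distinguishing_chromatic_number G \<le> card (SIGMA i:{1..r}. {..<k i})"
  proof (rule distinguishing_chromatic_number_le_card[where c = ?c])
    show "?c \<in> pverts G \<rightarrow> (SIGMA i:{1..r}. {..<k i})"
      using \<open>labeling G r h\<close> col by (fastforce simp: labeling_def colors_on_def Pi_iff)
    show "?c u \<noteq> ?c v" if "(u, v) \<in> parcs G" for u v
      using that wf col[of "h v"] by (auto simp: colors_on_def)
    show "p = id" if "automorphism G p" "\<And>v. v \<in> pverts G \<Longrightarrow> ?c (p v) = ?c v" for p
      using \<open>distinguishing G h\<close> that by (simp add: distinguishing_def)
  qed (use wf in auto)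
  then show ?thesis by simp
qed

lemma automorphism_complement:
  "automorphism (complement G) f \<longleftrightarrow> automorphism G f" if "\<And>v. (v, v) \<notin> parcs G"
proof -
  have "((f u, f v) \<in> parcs (complement G) \<longleftrightarrow> (u, v) \<in> parcs (complement G)) \<longleftrightarrow>
      ((f u, f v) \<in> parcs G \<longleftrightarrow> (u, v) \<in> parcs G)"
    if "f permutes pverts G" "u \<in> pverts G" "v \<in> pverts G" for u v
    using that \<open>\<And>v. (v, v) \<notin> parcs G\<close> permutes_in_image[OF that(1)]
      inj_eq[OF permutes_inj[OF that(1)]]
    by (auto simp: complement_def)
  then show ?thesis
    by (auto simp: automorphism_def complement_def)
qed

theorem theorem2p2:
  fixes G :: "'a pair_pre_digraph" and n :: nat
  assumes "pair_graph G"
    and "n = card (pverts G)"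
  shows "distinguishing_chromatic_number G + distinguishing_chromatic_number (complement G)
           \<le> n + distinguishing_number G"
proof -
  interpret pair_graph G by fact
  let ?D = "distinguishing_number G" and ?G' = "complement G"
  have wf: "parcs G \<subseteq> pverts G \<times> pverts G"
    using wellformed' by auto
  have sym: "sym (parcs G)"
    using pair_sym_arcs by (simp add: symmetric_def)
  have irrefl: "irrefl (parcs G)"
    using pair_no_loops by (fastforce simp: irrefl_def)
  have "\<exists>h. labeling G ?D h \<and> distinguishing G h"
    unfolding distinguishing_number_def
    by (rule LeastI_ex) (use ex_proper_distinguishing[OF \<open>pair_graph G\<close>] in blast)
  then obtain h where h: "labeling G ?D h" "distinguishing G h" by blast
  then have h': "labeling ?G' ?D h" "distinguishing ?G' h"
    using automorphism_complement[of G] irrefl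
    by (auto simp: labeling_def distinguishing_def complement_def irrefl_def)
  define V where "V i = {v \<in> pverts G. h v = i}" for i
  have "\<exists>a b f g. a + b \<le> card (V i) + 1 \<and> colors_on (parcs G) (V i) a f \<and>
      colors_on (- (parcs G \<union> Id)) (V i) b g" for i
    using nordhaus_gaddum[of "V i", OF _ sym irrefl] pair_finite_verts by (simp add: V_def)
  then obtain a b f g where ab: "\<And>i. a i + b i \<le> card (V i) + 1"
    and f: "\<And>i. colors_on (parcs G) (V i) (a i) (f i)"
    and g: "\<And>i. colors_on (- (parcs G \<union> Id)) (V i) (b i) (g i)" by metis
  have "distinguishing_chromatic_number G \<le> (\<Sum>i=1..?D. a i)"
    by (rule distinguishing_chromatic_number_le_sum[OF h wf f[unfolded V_def]])
  moreover have "distinguishing_chromatic_number ?G' \<le> (\<Sum>i=1..?D. b i)"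
  proof (rule distinguishing_chromatic_number_le_sum[OF h'])
    show "colors_on (parcs ?G') {v \<in> pverts ?G'. h v = i} (b i) (g i)" for i
      using g[of i] by (auto simp: colors_on_def V_def complement_def)
  qed (auto simp: complement_def)
  moreover have "(\<Sum>i=1..?D. a i) + (\<Sum>i=1..?D. b i) \<le> n + ?D"
  proof -
    have "(\<Sum>i=1..?D. a i) + (\<Sum>i=1..?D. b i) \<le> (\<Sum>i=1..?D. card (V i) + 1)"
      unfolding sum.distrib[symmetric] by (intro sum_mono ab)
    also have "\<dots> = (\<Sum>i=1..?D. card (V i)) + ?D"
      unfolding sum.distrib by simp
    also have "(\<Sum>i=1..?D. card (V i)) = card (\<Union>i\<in>{1..?D}. V i)"
      using pair_finite_verts by (subst card_UN_disjoint) (auto simp: V_def)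
    also have "\<dots> \<le> n"
      unfolding assms(2) using pair_finite_verts by (intro card_mono) (auto simp: V_def)
    finally show ?thesis by simp
  qed
  ultimately show ?thesis by linarith
qed

end
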